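(* Consider a broadcast channel with $N$ outputs having the direct-sum structure $\mathcal V_{\mathrm{out}}=\bigoplus_j\mathcal V_j$, $\operatorname{score}_{\mathrm{out}}(\dot\phi)=\bigoplus_j\operatorname{score}_j(\dot\phi)$ for all $\dot\phi\in\mathcal T_\theta$, and $\mathcal A(g)=\bigoplus_j\mathcal A(F_jf)$, as described in the context. Then the local channel maps obey $$F_{\mathrm{push}}=\sum_j\iota_jF_{j\,\mathrm{push}},\qquad F^{\mathrm{pull}}=\sum_jF_j{}^{\mathrm{pull}}\pi_j,\qquad \operatorname{Imap}=\sum_jF_j{}^{\mathrm{pull}}F_{j\,\mathrm{push}},$$ where $\iota_j:\mathcal A(F_jf)\to\mathcal A(g)$ is the injection map into the $j$th summand, $\pi_j=\iota_j^\dagger:\mathcal A(g)\to\mathcal A(F_jf)$ is the projection map, and $\operatorname{Imap}=F^{\mathrm{pull}}F_{\mathrm{push}}$.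
   Context: Input. $\mathcal T_\theta$ is a real vector space (tangent vectors $\dot\phi$ at a fixed parameter $\theta$). $\mathcal V$ is a real vector space with semi-inner product $\langle\cdot,\cdot\rangle_f$; $\operatorname{score}:\mathcal T_\theta\to\mathcal V$ is linear; $\mathcal N(f)$ is the set of zero-seminorm elements; $\mathcal A(f)$ is the Hilbert-space completion of $\mathcal V/\mathcal N(f)$; $f_{\mathrm{push}}\dot\phi=\operatorname{score}(\dot\phi)+\mathcal N(f)\in\mathcal A(f)$; $\mathcal T(f)=\overline{\operatorname{range}f_{\mathrm{push}}}$. Individual outputs. For $j=1,\dots,N$, $F_jf$ denotes the $j$th output, with its own real vector space $\mathcal V_j$, semi-inner product $\langle\cdot,\cdot\rangle_{F_jf}$, linear map $\operatorname{score}_j:\mathcal T_\theta\to\mathcal V_j$, zero-seminorm subspace $\mathcal N(F_jf)$ and Hilbert space $\mathcal A(F_jf)$, the completion of $\mathcal V_j/\mathcal N(F_jf)$. The individual channel pushforward $F_{j\,\mathrm{push}}:\mathcal T(f)\to\mathcal A(F_jf)$ is the bounded linear map (assumed to exist) satisfying $F_{j\,\mathrm{push}}f_{\mathrm{push}}\dot\phi=\operatorname{score}_j(\dot\phi)+\mathcal N(F_jf)$ for all $\dot\phi$, and $F_j{}^{\mathrm{pull}}=F_{j\,\mathrm{push}}^\dagger:\mathcal A(F_jf)\to\mathcal T(f)$ is its adjoint. Combined output $g$. $\mathcal V_{\mathrm{out}}=\bigoplus_j\mathcal V_j$ carries the semi-inner product $\langle\oplus_jA_j,\oplus_jB_j\rangle_g=\sum_j\langle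 A_j,B_j\rangle_{F_jf}$; $\mathcal N(g)$ is its zero-seminorm subspace; $\mathcal A(g)$, the completion of $\mathcal V_{\mathrm{out}}/\mathcal N(g)$, is identified with the Hilbert-space direct sum $\bigoplus_j\mathcal A(F_jf)$; $g_{\mathrm{push}}\dot\phi=\operatorname{score}_{\mathrm{out}}(\dot\phi)+\mathcal N(g)$. The channel pushforward $F_{\mathrm{push}}:\mathcal T(f)\to\mathcal A(g)$ is the bounded linear map with $g_{\mathrm{push}}=F_{\mathrm{push}}f_{\mathrm{push}}$, and $F^{\mathrm{pull}}=F_{\mathrm{push}}^\dagger$. *)

theory Defs
  imports "HOL-Analysis.Analysis"
begin

text \<open>
  HOL has no families of types, so a family of vector spaces (resp. Hilbert spaces) indexed by
  the outputs of a broadcast channel is represented by a family of subspaces (resp. complete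
  subspaces) of one ambient type. Nothing is lost: any family embeds into its own direct sum.
  The finite type \<^typ>\<open>'n\<close> indexes the outputs. Spaces that do not belong to a family are types,
  and enter the definitions below with carrier \<^term>\<open>UNIV\<close>.
\<close>

subsection \<open>Semi-inner products and Hilbert-space completions\<close>

definition semi_inner_product :: "'v::real_vector set \<Rightarrow> ('v \<Rightarrow> 'v \<Rightarrow> real) \<Rightarrow> bool" where
  "semi_inner_product V ip \<longleftrightarrow>
     (\<forall>x\<in>V. \<forall>y\<in>V. ip x y = ip y x) \<and>
     (\<forall>x\<in>V. \<forall>y\<in>V. \<forall>z\<in>V. ip (x + y) z = ip x z + ip y z) \<and>
     (\<forall>c. \<forall>x\<in>V. \<forall>y\<in>V. ip (c *\<^sub>R x) y = c * ip x y) \<and>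
     (\<forall>x\<in>V. 0 \<le> ip x x)"

definition null_space :: "'v set \<Rightarrow> ('v \<Rightarrow> 'v \<Rightarrow> real) \<Rightarrow> 'v set" where
  "null_space V ip = {x\<in>V. sqrt (ip x x) = 0}"

definition quotient_space :: "'v::real_vector set \<Rightarrow> ('v \<Rightarrow> 'v \<Rightarrow> real) \<Rightarrow> 'v set set" where
  "quotient_space V ip = (\<lambda>x. x +o null_space V ip) ` V"

text \<open>
  The complete inner product space \<^term>\<open>A\<close>, together with the embedding \<^term>\<open>emb\<close> of the
  pre-Hilbert space of cosets, is a completion of the quotient of \<^term>\<open>V\<close> by its null space.
\<close>

definition hilbert_completion ::
  "'v::real_vector set \<Rightarrow> ('v \<Rightarrow> 'v \<Rightarrow> real) \<Rightarrow> 'h::real_inner set \<Rightarrow> ('v set \<Rightarrow> 'h) \<Rightarrow> bool" where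
  "hilbert_completion V ip A emb \<longleftrightarrow>
     subspace A \<and> complete A \<and>
     emb ` quotient_space V ip \<subseteq> A \<and>
     (\<forall>x\<in>V. \<forall>y\<in>V. emb ((x + y) +o null_space V ip)
        = emb (x +o null_space V ip) + emb (y +o null_space V ip)) \<and>
     (\<forall>c. \<forall>x\<in>V. emb ((c *\<^sub>R x) +o null_space V ip) = c *\<^sub>R emb (x +o null_space V ip)) \<and>
     (\<forall>x\<in>V. \<forall>y\<in>V. emb (x +o null_space V ip) \<bullet> emb (y +o null_space V ip) = ip x y) \<and>
     A \<subseteq> closure (emb ` quotient_space V ip)"

subsection \<open>Pushforwards and adjoints\<close>

definition state_push ::
  "'v::real_vector set \<Rightarrow> ('v \<Rightarrow> 'v \<Rightarrow> real) \<Rightarrow> ('v set \<Rightarrow> 'h) \<Rightarrow> ('t \<Rightarrow> 'v) \<Rightarrow> 't \<Rightarrow> 'h" where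
  "state_push V ip emb score \<phi> = emb (score \<phi> +o null_space V ip)"

definition tangent_space :: "('t \<Rightarrow> 'h::topological_space) \<Rightarrow> 'h set" where
  "tangent_space f_push = closure (range f_push)"

definition bounded_linear_between ::
  "'a::real_normed_vector set \<Rightarrow> 'b::real_normed_vector set \<Rightarrow> ('a \<Rightarrow> 'b) \<Rightarrow> bool" where
  "bounded_linear_between X Y F \<longleftrightarrow>
     F ` X \<subseteq> Y \<and>
     (\<forall>x\<in>X. \<forall>y\<in>X. F (x + y) = F x + F y) \<and>
     (\<forall>c. \<forall>x\<in>X. F (c *\<^sub>R x) = c *\<^sub>R F x) \<and>
     (\<exists>K. \<forall>x\<in>X. norm (F x) \<le> K * norm x)"

definition is_channel_push ::
  "('t \<Rightarrow> 'a::real_normed_vector) \<Rightarrow> 'b::real_normed_vector set \<Rightarrow> ('t \<Rightarrow> 'b) \<Rightarrow> ('a \<Rightarrow> 'b) \<Rightarrow> bool" where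
  "is_channel_push f_push B g_push F \<longleftrightarrow>
     bounded_linear_between (tangent_space f_push) B F \<and> (\<forall>\<phi>. F (f_push \<phi>) = g_push \<phi>)"

text \<open>
  The choices below are unique where it matters: a channel pushforward is determined on the
  tangent space by density, and an adjoint is determined on \<^term>\<open>Y\<close>.
\<close>

definition channel_push ::
  "('t \<Rightarrow> 'a::real_normed_vector) \<Rightarrow> 'b::real_normed_vector set \<Rightarrow> ('t \<Rightarrow> 'b) \<Rightarrow> 'a \<Rightarrow> 'b" where
  "channel_push f_push B g_push = (SOME F. is_channel_push f_push B g_push F)"

definition adjoint_between ::
  "'a::real_inner set \<Rightarrow> 'b::real_inner set \<Rightarrow> ('a \<Rightarrow> 'b) \<Rightarrow> 'b \<Rightarrow> 'a" where
  "adjoint_between X Y F = (SOME G. G ` Y \<subseteq> X \<and> (\<forall>x\<in>X. \<forall>y\<in>Y. F x \<bullet> y = x \<bullet> G y))"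

subsection \<open>Direct sums\<close>

text \<open>
  The inner product of the type \<^typ>\<open>'h::real_inner ^ 'n\<close> is the sum of the componentwise ones, so
  for complete subspaces the following is the Hilbert-space direct sum; the injection into the
  summand \<open>j\<close> is \<^term>\<open>axis j\<close>.
\<close>

definition direct_sum :: "('n::finite \<Rightarrow> 'w set) \<Rightarrow> ('w ^ 'n) set" where
  "direct_sum V = {x. \<forall>j. x $ j \<in> V j}"

definition direct_sum_ip :: "('n::finite \<Rightarrow> 'w \<Rightarrow> 'w \<Rightarrow> real) \<Rightarrow> 'w ^ 'n \<Rightarrow> 'w ^ 'n \<Rightarrow> real" where
  "direct_sum_ip ip x y = (\<Sum>j\<in>UNIV. ip j (x $ j) (y $ j))"

text \<open>
  The embedding that identifies the completion of the quotient of the direct sum with the direct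
  sum of the completions: componentwise, a coset of the null space of the direct sum is a coset
  of the null space of the summand (see \<open>direct_sum_embed_coset\<close>).
\<close>

definition direct_sum_embed ::
  "('n::finite \<Rightarrow> 'w set \<Rightarrow> 'h) \<Rightarrow> ('w ^ 'n) set \<Rightarrow> 'h ^ 'n" where
  "direct_sum_embed emb C = (\<chi> j. emb j ((\<lambda>x. x $ j) ` C))"

lemma subspace_direct_sum:
  assumes "\<And>j. subspace (V j)"
  shows "subspace (direct_sum V)"
  using assms by (auto simp: direct_sum_def subspace_def)

lemma semi_inner_product_direct_sum:
  assumes "\<And>j. semi_inner_product (V j) (ip j)"
  shows "semi_inner_product (direct_sum V) (direct_sum_ip ip)"
  unfolding semi_inner_product_def
proof (intro conjI ballI allI)
  fix x y z c assume xyz: "x \<in> direct_sum V" "y \<in> direct_sum V" "z \<in> direct_sum V"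
  then have mem: "x $ j \<in> V j" "y $ j \<in> V j" "z $ j \<in> V j" for j
    by (simp_all add: direct_sum_def)
  note ip = assms[unfolded semi_inner_product_def]
  show "direct_sum_ip ip x y = direct_sum_ip ip y x"
    unfolding direct_sum_ip_def using ip mem by (intro sum.cong) blast+
  have "ip j ((x + y) $ j) (z $ j) = ip j (x $ j) (z $ j) + ip j (y $ j) (z $ j)" for j
    unfolding vector_add_component using ip[of j] mem[of j] by blast
  then show "direct_sum_ip ip (x + y) z = direct_sum_ip ip x z + direct_sum_ip ip y z"
    unfolding direct_sum_ip_def by (simp only: sum.distrib)
  have "ip j ((c *\<^sub>R x) $ j) (y $ j) = c * ip j (x $ j) (y $ j)" for j
    unfolding vector_scaleR_component using ip[of j] mem[of j] by blast
  then show "direct_sum_ip ip (c *\<^sub>R x) y = c * direct_sum_ip ip x y"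
    unfolding direct_sum_ip_def by (simp only: sum_distrib_left)
next
  fix x assume "x \<in> direct_sum V"
  then show "0 \<le> direct_sum_ip ip x x"
    using assms unfolding direct_sum_ip_def direct_sum_def semi_inner_product_def
    by (intro sum_nonneg) blast
qed

lemma null_space_direct_sum:
  assumes "\<And>j. semi_inner_product (V j) (ip j)"
  shows "null_space (direct_sum V) (direct_sum_ip ip) = direct_sum (\<lambda>j. null_space (V j) (ip j))"
proof -
  have "(direct_sum_ip ip x x = 0) \<longleftrightarrow> (\<forall>j. ip j (x $ j) (x $ j) = 0)"
    if "x \<in> direct_sum V" for x
  proof -
    have "0 \<le> ip j (x $ j) (x $ j)" for j
      using that assms[of j] unfolding direct_sum_def semi_inner_product_def by blast
    then show ?thesis
      unfolding direct_sum_ip_def by (subst sum_nonneg_eq_0_iff) auto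
  qed
  then show ?thesis
    by (auto simp: null_space_def direct_sum_def)
qed

lemma direct_sum_embed_coset:
  assumes "\<And>j. subspace (V j)" and "\<And>j. semi_inner_product (V j) (ip j)"
  shows "direct_sum_embed emb (x +o null_space (direct_sum V) (direct_sum_ip ip)) $ j
    = emb j (x $ j +o null_space (V j) (ip j))"
proof -
  have ip0: "ip i 0 0 = 0" for i
  proof -
    have "0 \<in> V i" using assms(1) by (simp add: subspace_0)
    then have "ip i (0 *\<^sub>R 0) 0 = 0 * ip i 0 0"
      using assms(2)[of i] unfolding semi_inner_product_def by blast
    then show ?thesis by simp
  qed
  have "(\<lambda>x. x $ j) ` (x +o null_space (direct_sum V) (direct_sum_ip ip))
    = x $ j +o null_space (V j) (ip j)" (is "?L = ?R")
  proof
    show "?L \<subseteq> ?R"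
      unfolding null_space_direct_sum[of V ip, OF assms(2)]
      by (auto simp: elt_set_plus_def direct_sum_def)
    show "?R \<subseteq> ?L"
    proof
      fix z assume "z \<in> ?R"
      then obtain b where b: "b \<in> null_space (V j) (ip j)" "z = x $ j + b"
        by (auto simp: elt_set_plus_def)
      have "axis j b \<in> direct_sum (\<lambda>j. null_space (V j) (ip j))"
        using b assms(1) ip0 by (auto simp: direct_sum_def axis_def null_space_def subspace_0)
      then have "x + axis j b \<in> x +o null_space (direct_sum V) (direct_sum_ip ip)"
        unfolding null_space_direct_sum[of V ip, OF assms(2)] by (auto simp: elt_set_plus_def)
      moreover have "z = (x + axis j b) $ j" using b by simp
      ultimately show "z \<in> ?L" by blast
    qed
  qed
  then show ?thesis by (simp add: direct_sum_embed_def)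
qed

lemma complete_direct_sum:
  fixes A :: "'n::finite \<Rightarrow> 'h::metric_space set"
  assumes "\<And>j. complete (A j)"
  shows "complete (direct_sum A)"
  unfolding complete_def
proof (intro allI impI)
  fix f :: "nat \<Rightarrow> 'h ^ 'n" assume f: "(\<forall>n. f n \<in> direct_sum A) \<and> Cauchy f"
  have "\<exists>l\<in>A j. (\<lambda>n. f n $ j) \<longlonglongrightarrow> l" for j
    using f Cauchy_vec_nth[of f j]
    by (intro assms[of j, unfolded complete_def, rule_format]) (auto simp: direct_sum_def)
  then obtain l where l: "\<And>j. l j \<in> A j" "\<And>j. (\<lambda>n. f n $ j) \<longlonglongrightarrow> l j" by metis
  then have "f \<longlonglongrightarrow> (\<chi> j. l j)" by (intro vec_tendstoI) simp
  moreover have "(\<chi> j. l j) \<in> direct_sum A" using l by (simp add: direct_sum_def)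
  ultimately show "\<exists>l\<in>direct_sum A. f \<longlonglongrightarrow> l" by blast
qed

lemma hilbert_completion_direct_sum:
  fixes V :: "'n::finite \<Rightarrow> 'w::real_vector set" and A :: "'n \<Rightarrow> 'h::real_inner set"
  assumes V: "\<And>j. subspace (V j)" and ip: "\<And>j. semi_inner_product (V j) (ip j)"
    and compl: "\<And>j. hilbert_completion (V j) (ip j) (A j) (emb j)"
  shows "hilbert_completion (direct_sum V) (direct_sum_ip ip) (direct_sum A) (direct_sum_embed emb)"
proof -
  note coset = direct_sum_embed_coset[of V ip emb, OF V ip]
  let ?N = "null_space (direct_sum V) (direct_sum_ip ip)"
  let ?e = "direct_sum_embed emb"
  have "\<exists>x. (\<forall>n. x n \<in> V j) \<and> (\<lambda>n. emb j (x n +o null_space (V j) (ip j))) \<longlonglongrightarrow> a"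
    if "a \<in> A j" for a j
  proof -
    have "a \<in> closure (emb j ` quotient_space (V j) (ip j))"
      using compl[of j] that by (auto simp: hilbert_completion_def)
    then obtain y where y: "\<And>n. y n \<in> emb j ` quotient_space (V j) (ip j)" "y \<longlonglongrightarrow> a"
      unfolding closure_sequential by blast
    then have "\<forall>n. \<exists>x\<in>V j. y n = emb j (x +o null_space (V j) (ip j))"
      by (auto simp: quotient_space_def)
    then obtain x where "\<And>n. x n \<in> V j" "\<And>n. y n = emb j (x n +o null_space (V j) (ip j))"
      by metis
    then show ?thesis using y(2) by (metis (no_types, lifting) ext)
  qed
  then have approx: "\<exists>X. \<forall>a\<in>A j. (\<forall>n. X a n \<in> V j) \<and>
      (\<lambda>n. emb j (X a n +o null_space (V j) (ip j))) \<longlonglongrightarrow> a" for j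
    by (intro bchoice ballI)
  have dense: "direct_sum A \<subseteq> closure (?e ` quotient_space (direct_sum V) (direct_sum_ip ip))"
  proof
    fix a assume a: "a \<in> direct_sum A"
    have "\<exists>X. \<forall>j. \<forall>b\<in>A j. (\<forall>n. X j b n \<in> V j) \<and>
        (\<lambda>n. emb j (X j b n +o null_space (V j) (ip j))) \<longlonglongrightarrow> b"
      using approx by (intro choice allI)
    then obtain X where X: "\<And>j b. b \<in> A j \<Longrightarrow> (\<forall>n. X j b n \<in> V j) \<and>
        (\<lambda>n. emb j (X j b n +o null_space (V j) (ip j))) \<longlonglongrightarrow> b"
      by blast
    define x where "x n = (\<chi> j. X j (a $ j) n)" for n
    have x: "x n \<in> direct_sum V" for n
      using X a by (auto simp: x_def direct_sum_def)
    have "(\<lambda>n. ?e (x n +o ?N)) \<longlonglongrightarrow> a"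
    proof (rule vec_tendstoI)
      fix j
      have "a $ j \<in> A j" using a by (simp add: direct_sum_def)
      then show "(\<lambda>n. ?e (x n +o ?N) $ j) \<longlonglongrightarrow> a $ j"
        using X[of "a $ j" j] by (simp add: coset x_def)
    qed
    then show "a \<in> closure (?e ` quotient_space (direct_sum V) (direct_sum_ip ip))"
      unfolding closure_sequential quotient_space_def
      using x by (intro exI[of _ "\<lambda>n. ?e (x n +o ?N)"]) auto
  qed
  have into: "?e ` quotient_space (direct_sum V) (direct_sum_ip ip) \<subseteq> direct_sum A"
  proof -
    have "emb j (x +o null_space (V j) (ip j)) \<in> A j" if "x \<in> V j" for x j
      using compl[of j] that by (auto simp: hilbert_completion_def quotient_space_def)
    moreover have "x $ j \<in> V j" if "x \<in> direct_sum V" for x j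
      using that by (simp add: direct_sum_def)
    ultimately have "?e (x +o ?N) \<in> direct_sum A" if "x \<in> direct_sum V" for x
      using that unfolding direct_sum_def[of A] mem_Collect_eq coset by blast
    then show ?thesis unfolding quotient_space_def by blast
  qed
  have sub: "subspace (direct_sum A)"
    using compl by (intro subspace_direct_sum) (auto simp: hilbert_completion_def)
  have com: "complete (direct_sum A)"
    using compl by (intro complete_direct_sum) (auto simp: hilbert_completion_def)
  have add: "?e ((x + y) +o ?N) = ?e (x +o ?N) + ?e (y +o ?N)"
    if "x \<in> direct_sum V" "y \<in> direct_sum V" for x y
    unfolding vec_eq_iff coset vector_add_component
    using compl that unfolding hilbert_completion_def direct_sum_def by blast
  have scale: "?e ((c *\<^sub>R x) +o ?N) = c *\<^sub>R ?e (x +o ?N)" if "x \<in> direct_sum V" for c x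
    unfolding vec_eq_iff coset vector_scaleR_component
    using compl that unfolding hilbert_completion_def direct_sum_def by blast
  have inner: "?e (x +o ?N) \<bullet> ?e (y +o ?N) = direct_sum_ip ip x y"
    if "x \<in> direct_sum V" "y \<in> direct_sum V" for x y
    unfolding inner_vec_def coset direct_sum_ip_def
    using compl that unfolding hilbert_completion_def direct_sum_def by (intro sum.cong) blast+
  show ?thesis
    unfolding hilbert_completion_def[of "direct_sum V"]
    using sub com into add scale inner dense by blast
qed

lemma adjoint_between_axis:
  fixes A :: "'n::finite \<Rightarrow> 'h::real_inner set"
  assumes A: "\<And>j. subspace (A j)" and y: "y \<in> direct_sum A"
  shows "adjoint_between (A j) (direct_sum A) (axis j) y = y $ j"
proof -
  have ax: "axis j x \<bullet> z = x \<bullet> z $ j" for x :: 'h and z :: "'h ^ 'n"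
    by (simp add: inner_axis inner_commute)
  define P where "P G \<longleftrightarrow> G ` direct_sum A \<subseteq> A j \<and>
    (\<forall>x\<in>A j. \<forall>y\<in>direct_sum A. axis j x \<bullet> y = x \<bullet> G y)" for G :: "'h ^ 'n \<Rightarrow> 'h"
  have "P (\<lambda>y. y $ j)" by (auto simp: P_def ax direct_sum_def)
  then have "P (adjoint_between (A j) (direct_sum A) (axis j))"
    unfolding adjoint_between_def P_def[symmetric] by (rule someI[of P])
  moreover define d where "d = adjoint_between (A j) (direct_sum A) (axis j) y - y $ j"
  moreover have "y $ j \<in> A j" using y by (simp add: direct_sum_def)
  ultimately have "d \<in> A j" and "\<forall>x\<in>A j. x \<bullet> d = 0"
    using A[of j] y by (auto simp: P_def ax image_subset_iff inner_diff_right intro!: subspace_diff)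
  then have "d \<bullet> d = 0" by blast
  then show ?thesis by (simp add: d_def)
qed

end

(* Density of the range of f_push in the tangent space determines F_push, and the family of the
   F_j,push is a candidate for it. Reading off the components of the inner product of the direct
   sum gives the pullback formula, once the adjoints of the F_j,push exist; that is the Riesz
   representation theorem on a complete subspace, which is proved by minimising
   |x|^2 - 2 phi(x): by the parallelogram law, every minimising sequence is Cauchy. *)

theory Submission
  imports Defs
begin

section \<open>Functionals and adjoints on a complete subspace\<close>

lemma continuous_on_bounded_linear_between:
  assumes X: "subspace X" and F: "bounded_linear_between X Y F"
  shows "continuous_on X F"
proof -
  obtain K where K: "\<And>x. x \<in> X \<Longrightarrow> norm (F x) \<le> K * norm x"
    using F unfolding bounded_linear_between_def by blast
  have "norm (F x - F y) \<le> K * norm (x - y)" if "x \<in> X" "y \<in> X" for x y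
  proof -
    have xy: "x - y \<in> X" using X that by (rule subspace_diff)
    then have "F (x - y + y) = F (x - y) + F y"
      using F that unfolding bounded_linear_between_def by blast
    with K[OF xy] show ?thesis by simp
  qed
  \<comment> \<open>The bound \<open>K\<close> can be negative when \<open>X\<close> is trivial,
    whereas a Lipschitz constant must be nonnegative.\<close>
  then have "dist (F x) (F y) \<le> \<bar>K\<bar> * dist x y" if "x \<in> X" "y \<in> X" for x y
    unfolding dist_norm using that
    by (blast intro: order_trans mult_right_mono abs_ge_self norm_ge_zero)
  then have "\<bar>K\<bar>-lipschitz_on X F" by (intro lipschitz_onI) auto
  then show ?thesis by (rule lipschitz_on_continuous_on)
qed

text \<open>If \<open>\<phi>\<close> is the inner product with \<open>g\<close>, then the functional
  \<open>J\<close> below equals |x - g|^2 - |g|^2, so \<open>g\<close> can only be its minimiser.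
  Completeness supplies a minimiser, and the vanishing of the first variation there is the
  representation.\<close>

lemma riesz_representation_complete_subspace:
  fixes \<phi> :: "'a::real_inner \<Rightarrow> real"
  assumes X: "subspace X" "complete X" and \<phi>: "bounded_linear_between X UNIV \<phi>"
  obtains g where "g \<in> X" "\<And>x. x \<in> X \<Longrightarrow> \<phi> x = x \<bullet> g"
proof -
  have add: "\<phi> (x + y) = \<phi> x + \<phi> y" if "x \<in> X" "y \<in> X" for x y
    using \<phi> that by (simp add: bounded_linear_between_def)
  have scale: "\<phi> (c *\<^sub>R x) = c * \<phi> x" if "x \<in> X" for c x
    using \<phi> that by (simp add: bounded_linear_between_def)
  obtain K where K: "\<And>x. x \<in> X \<Longrightarrow> \<bar>\<phi> x\<bar> \<le> K * norm x"
    using \<phi> unfolding bounded_linear_between_def real_norm_def by blast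
  define J where "J x = x \<bullet> x - 2 * \<phi> x" for x
  define m where "m = Inf (J ` X)"
  \<comment> \<open>Since 2 K |x| is at most K^2 + |x|^2, the functional \<open>J\<close> is bounded
    below and its infimum is meaningful.\<close>
  have "- K\<^sup>2 \<le> J x" if "x \<in> X" for x
  proof -
    have "2 * \<phi> x \<le> 2 * (K * norm x)" using K[OF that] by linarith
    also have "\<dots> \<le> (norm x)\<^sup>2 + K\<^sup>2" using sum_squares_bound[of K "norm x"] by simp
    finally show ?thesis by (simp add: J_def power2_norm_eq_inner)
  qed
  then have bdd: "bdd_below (J ` X)" by (rule bdd_belowI2)
  then have m_le: "m \<le> J x" if "x \<in> X" for x
    unfolding m_def using that by (auto intro: cInf_lower)
  have "\<exists>x\<in>X. J x < m + e" if "e > 0" for e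
    using cInf_lessD[of "J ` X" "m + e"] that subspace_0[OF X(1)] by (auto simp: m_def)
  then have "\<forall>n. \<exists>x\<in>X. J x < m + inverse (real (Suc n))" by simp
  then obtain u where u: "\<And>n. u n \<in> X" "\<And>n. J (u n) < m + inverse (real (Suc n))"
    by metis
  have J_lim: "(\<lambda>n. J (u n)) \<longlonglongrightarrow> m"
  proof (rule tendsto_sandwich)
    show "\<forall>\<^sub>F n in sequentially. m \<le> J (u n)"
      by (intro always_eventually allI m_le u)
    show "\<forall>\<^sub>F n in sequentially. J (u n) \<le> m + inverse (real (Suc n))"
      by (intro always_eventually allI less_imp_le u)
    show "(\<lambda>n. m + inverse (real (Suc n))) \<longlonglongrightarrow> m"
      using tendsto_add[OF tendsto_const[of m] LIMSEQ_inverse_real_of_nat] by simp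
  qed simp
  \<comment> \<open>By the parallelogram law and additivity of \<open>\<phi>\<close>, the left side
    is exactly 2 J(x) + 2 J(y) - 4 J((x + y)/2), and the midpoint lies in \<open>X\<close>, where
    \<open>J\<close> is at least \<open>m\<close>.\<close>
  have gap: "(norm (x - y))\<^sup>2 \<le> 2 * (J x - m) + 2 * (J y - m)" if "x \<in> X" "y \<in> X" for x y
  proof -
    have "m \<le> J ((1/2) *\<^sub>R (x + y))"
      using that X(1) by (intro m_le subspace_scale subspace_add)
    moreover have "\<phi> ((1/2) *\<^sub>R (x + y)) = (\<phi> x + \<phi> y) / 2"
      using that X(1) by (simp add: scale add subspace_add)
    ultimately show ?thesis
      by (simp add: J_def power2_norm_eq_inner inner_simps inner_commute algebra_simps)
  qed
  have "Cauchy u"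
  proof (rule metric_CauchyI)
    fix e :: real assume "e > 0"
    \<comment> \<open>Two excesses below e^2/4, each doubled in \<open>gap\<close>, add up to less
      than e^2.\<close>
    then have "\<forall>\<^sub>F n in sequentially. J (u n) < m + e\<^sup>2 / 4"
      by (intro order_tendstoD(2)[OF J_lim]) simp
    then obtain M where M: "\<And>n. n \<ge> M \<Longrightarrow> J (u n) < m + e\<^sup>2 / 4"
      by (auto simp: eventually_sequentially)
    have "dist (u n) (u k) < e" if "n \<ge> M" "k \<ge> M" for n k
    proof -
      have "(norm (u n - u k))\<^sup>2 < e\<^sup>2"
        using gap[OF u(1) u(1), of n k] M[OF that(1)] M[OF that(2)] by simp
      then show ?thesis using \<open>e > 0\<close> by (simp add: dist_norm power_less_imp_less_base)
    qed
    then show "\<exists>M. \<forall>n\<ge>M. \<forall>k\<ge>M. dist (u n) (u k) < e" by blast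
  qed
  then obtain g where g: "g \<in> X" "u \<longlonglongrightarrow> g"
    using X(2) u(1) by (auto simp: complete_def)
  have "J g \<le> m"
  proof -
    have "(\<lambda>n. \<phi> (u n)) \<longlonglongrightarrow> \<phi> g"
      using continuous_on_bounded_linear_between[OF X(1) \<phi>] g u(1)
      by (auto simp: continuous_on_sequentially o_def)
    then have "(\<lambda>n. J (u n)) \<longlonglongrightarrow> J g"
      unfolding J_def using g(2) by (intro tendsto_intros)
    then show ?thesis using J_lim LIMSEQ_unique by blast
  qed
  show thesis
  proof (rule that[OF g(1)])
    fix x assume x: "x \<in> X"
    \<comment> \<open>The defect \<open>b\<close> is to be shown zero. Moving from \<open>g\<close>
      to \<open>g + t *\<^sub>R x\<close> changes \<open>J\<close> by t^2 a + 2 t b, which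
      minimality keeps nonnegative.\<close>
    define a b where "a = x \<bullet> x" and "b = x \<bullet> g - \<phi> x"
    have nonneg: "0 \<le> t\<^sup>2 * a + 2 * t * b" for t
    proof -
      have "J g \<le> J (g + t *\<^sub>R x)"
        using \<open>J g \<le> m\<close> m_le[of "g + t *\<^sub>R x"] x g(1) X(1)
        by (simp add: subspace_add subspace_scale)
      moreover have "\<phi> (g + t *\<^sub>R x) = \<phi> g + t * \<phi> x"
        using x g(1) X(1) by (simp add: add scale subspace_scale)
      ultimately show ?thesis
        by (simp add: J_def a_def b_def inner_simps inner_commute algebra_simps power2_eq_square)
    qed
    \<comment> \<open>The quadratic is smallest at t = -b/a; the denominator a + 1 avoids division
      by zero when x = 0. At t = -c its value is -c^2 (a + 2), which forces c = 0.\<close>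
    define c where "c = b / (a + 1)"
    have "a \<ge> 0" by (simp add: a_def)
    then have b: "b = c * (a + 1)" by (simp add: c_def)
    have "c\<^sup>2 * (a + 2) \<le> 0"
      using nonneg[of "- c"] unfolding b by (simp add: algebra_simps power2_eq_square)
    with \<open>a \<ge> 0\<close> have "c = 0" by (simp add: mult_le_0_iff)
    with b have "b = 0" by simp
    then show "\<phi> x = x \<bullet> g" by (simp add: b_def)
  qed
qed

text \<open>For each fixed \<open>y\<close>, Cauchy-Schwarz makes the map sending \<open>x\<close>
  to \<open>F x \<bullet> y\<close> a bounded functional on \<open>X\<close>. Its Riesz vectors form
  an adjoint, so the choice in \<open>adjoint_between\<close> has a witness.\<close>

lemma adjoint_between_works:
  assumes X: "subspace X" "complete X" and F: "bounded_linear_between X Y F"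
  shows "adjoint_between X Y F ` Y \<subseteq> X"
    and "\<And>x y. x \<in> X \<Longrightarrow> y \<in> Y \<Longrightarrow> F x \<bullet> y = x \<bullet> adjoint_between X Y F y"
proof -
  have "\<exists>g\<in>X. \<forall>x\<in>X. F x \<bullet> y = x \<bullet> g" for y
  proof -
    obtain K where K: "\<And>x. x \<in> X \<Longrightarrow> norm (F x) \<le> K * norm x"
      using F unfolding bounded_linear_between_def by blast
    have "norm (F x \<bullet> y) \<le> (K * norm y) * norm x" if "x \<in> X" for x
    proof -
      have "norm (F x \<bullet> y) \<le> norm (F x) * norm y" by (simp add: Cauchy_Schwarz_ineq2)
      also have "\<dots> \<le> (K * norm x) * norm y" by (intro mult_right_mono K that norm_ge_zero)
      finally show ?thesis by (simp add: mult_ac)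
    qed
    then have "bounded_linear_between X UNIV (\<lambda>x. F x \<bullet> y)"
      using F by (auto simp: bounded_linear_between_def inner_add_left)
    then show ?thesis by (rule riesz_representation_complete_subspace[OF X]) blast
  qed
  then have "\<exists>G. \<forall>y. G y \<in> X \<and> (\<forall>x\<in>X. F x \<bullet> y = x \<bullet> G y)" by metis
  then have "\<exists>G. G ` Y \<subseteq> X \<and> (\<forall>x\<in>X. \<forall>y\<in>Y. F x \<bullet> y = x \<bullet> G y)" by blast
  from someI_ex[OF this] show "adjoint_between X Y F ` Y \<subseteq> X"
    and "\<And>x y. x \<in> X \<Longrightarrow> y \<in> Y \<Longrightarrow> F x \<bullet> y = x \<bullet> adjoint_between X Y F y"
    unfolding adjoint_between_def by blast+
qed

text \<open>The difference of two candidates lies in \<open>X\<close> and is orthogonal to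
  \<open>X\<close>, hence to itself. A pullback formula is thereby reduced to an identity of inner
  products.\<close>

lemma adjoint_between_eqI:
  assumes X: "subspace X" "complete X" and F: "bounded_linear_between X Y F"
    and "y \<in> Y" "g \<in> X" and g: "\<And>x. x \<in> X \<Longrightarrow> F x \<bullet> y = x \<bullet> g"
  shows "adjoint_between X Y F y = g"
proof -
  let ?d = "adjoint_between X Y F y - g"
  have "?d \<in> X"
    using adjoint_between_works(1)[OF X F] assms(4,5) X(1) by (auto intro: subspace_diff)
  then have "?d \<bullet> ?d = 0"
    using adjoint_between_works(2)[OF X F _ \<open>y \<in> Y\<close>, of ?d] g[of ?d]
    by (simp add: inner_diff_right)
  then show ?thesis by simp
qed

section \<open>Existence and uniqueness of channel pushforwards\<close>

lemma is_channel_push_channel_push: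
  assumes "is_channel_push f B g F"
  shows "is_channel_push f B g (channel_push f B g)"
  unfolding channel_push_def
  using assms by (rule someI[of "is_channel_push f B g"])

text \<open>The difference of the two maps is continuous on the tangent space and vanishes on the
  dense range of \<open>f\<close>. Off the tangent space the two may differ.\<close>

lemma is_channel_push_unique:
  assumes T: "subspace (tangent_space f)"
    and F: "is_channel_push f B g F" and G: "is_channel_push f B g G"
    and x: "x \<in> tangent_space f"
  shows "F x = G x"
proof -
  have "continuous_on (closure (range f)) (\<lambda>x. F x - G x)"
    using F G T unfolding is_channel_push_def tangent_space_def
    by (intro continuous_on_diff continuous_on_bounded_linear_between) blast+
  moreover have "F y - G y = 0" if "y \<in> range f" for y
    using F G that by (auto simp: is_channel_push_def)
  ultimately have "F x - G x = 0"
    using x unfolding tangent_space_def by (rule continuous_constant_on_closure)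
  then show ?thesis by simp
qed

text \<open>The norm of a vector is at most the sum of the norms of its finitely many components, so
  the individual bounds add up to one for the combined map.\<close>

lemma is_channel_push_direct_sum:
  fixes F :: "'n::finite \<Rightarrow> 'a::real_normed_vector \<Rightarrow> 'h::real_inner"
  assumes F: "\<And>j. is_channel_push f (B j) (g j) (F j)"
  shows "is_channel_push f (direct_sum B) (\<lambda>\<phi>. \<chi> j. g j \<phi>) (\<lambda>x. \<chi> j. F j x)"
proof -
  let ?T = "tangent_space f"
  have "\<exists>K. \<forall>x\<in>?T. norm (F j x) \<le> K * norm x" for j
    using F[of j] by (simp add: is_channel_push_def bounded_linear_between_def)
  then obtain K where K: "\<And>j x. x \<in> ?T \<Longrightarrow> norm (F j x) \<le> K j * norm x" by metis
  have "norm (\<chi> j. F j x) \<le> (\<Sum>j\<in>UNIV. K j) * norm x" if "x \<in> ?T" for x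
  proof -
    have "norm (\<chi> j. F j x) \<le> (\<Sum>j\<in>UNIV. norm (F j x))"
      by (simp add: norm_vec_def L2_set_le_sum)
    also have "\<dots> \<le> (\<Sum>j\<in>UNIV. K j) * norm x"
      unfolding sum_distrib_right by (intro sum_mono K that)
    finally show ?thesis .
  qed
  moreover have "F j x \<in> B j" if "x \<in> ?T" for x j
    using F[of j] that by (auto simp: is_channel_push_def bounded_linear_between_def)
  ultimately show ?thesis
    using F unfolding is_channel_push_def bounded_linear_between_def
    by (auto simp: direct_sum_def vec_eq_iff)
qed

section \<open>Linear structure of the tangent space\<close>

lemma subspace_closure:
  fixes S :: "'a::real_normed_vector set"
  assumes S: "subspace S"
  shows "subspace (closure S)"
proof (rule subspaceI)
  show "0 \<in> closure S" using subspace_0[OF S] closure_subset by blast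
next
  fix x y assume "x \<in> closure S" "y \<in> closure S"
  then obtain u v where "\<And>n. u n \<in> S" "u \<longlonglongrightarrow> x" "\<And>n. v n \<in> S" "v \<longlonglongrightarrow> y"
    unfolding closure_sequential by metis
  then show "x + y \<in> closure S"
    unfolding closure_sequential
    by (intro exI[of _ "\<lambda>n. u n + v n"]) (auto intro: tendsto_add subspace_add[OF S])
next
  fix c x assume "x \<in> closure S"
  then obtain u where "\<And>n. u n \<in> S" "u \<longlonglongrightarrow> x"
    unfolding closure_sequential by metis
  then show "c *\<^sub>R x \<in> closure S"
    unfolding closure_sequential
    by (intro exI[of _ "\<lambda>n. c *\<^sub>R u n"]) (auto intro: tendsto_scaleR subspace_scale[OF S])
qed

text \<open>The embedding respects sums and multiples of cosets with representatives in
  \<open>V\<close>, and the scores lie there, so the pushforward is linear. The closure of its range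
  is the tangent space.\<close>

lemma subspace_range_state_push:
  assumes compl: "hilbert_completion V ip A emb"
    and score: "linear score" "range score \<subseteq> V"
  shows "subspace (range (state_push V ip emb score))"
proof -
  have V: "score \<phi> \<in> V" for \<phi> using score(2) by blast
  note push = compl[unfolded hilbert_completion_def]
  have "state_push V ip emb score (\<phi> + \<psi>)
      = state_push V ip emb score \<phi> + state_push V ip emb score \<psi>" for \<phi> \<psi>
    unfolding state_push_def linear_add[OF score(1)] using push V by blast
  moreover have "state_push V ip emb score (c *\<^sub>R \<phi>) = c *\<^sub>R state_push V ip emb score \<phi>" for c \<phi>
    unfolding state_push_def linear_scale[OF score(1)] using push V by blast
  ultimately have "linear (state_push V ip emb score)" by (rule linearI)
  then show ?thesis using subspace_UNIV by (rule linear_subspace_image)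
qed

theorem theoremV1:
  fixes ip\<^sub>f :: "'v::real_vector \<Rightarrow> 'v \<Rightarrow> real"
    and emb\<^sub>f :: "'v set \<Rightarrow> 'a::real_inner"
    and score :: "'t::real_vector \<Rightarrow> 'v"
    and V :: "'n::finite \<Rightarrow> 'w::real_vector set"
    and ip :: "'n \<Rightarrow> 'w \<Rightarrow> 'w \<Rightarrow> real"
    and A :: "'n \<Rightarrow> 'h::real_inner set"
    and emb :: "'n \<Rightarrow> 'w set \<Rightarrow> 'h"
    and score_j :: "'n \<Rightarrow> 't \<Rightarrow> 'w"
    and score_out :: "'t \<Rightarrow> 'w ^ 'n"
    and f_push :: "'t \<Rightarrow> 'a"
    and g_push :: "'t \<Rightarrow> 'h ^ 'n"
    and Fj_push :: "'n \<Rightarrow> 'a \<Rightarrow> 'h"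
    and Fj_pull :: "'n \<Rightarrow> 'h \<Rightarrow> 'a"
    and F_push :: "'a \<Rightarrow> 'h ^ 'n"
    and F_pull :: "'h ^ 'n \<Rightarrow> 'a"
    and \<iota> :: "'n \<Rightarrow> 'h \<Rightarrow> 'h ^ 'n"
    and \<pi> :: "'n \<Rightarrow> 'h ^ 'n \<Rightarrow> 'h"
    and Imap :: "'a \<Rightarrow> 'a"
  assumes input_ip: "semi_inner_product UNIV ip\<^sub>f"
    and input_completion: "hilbert_completion UNIV ip\<^sub>f UNIV emb\<^sub>f"
    and input_score: "linear score"
    and output_space: "\<And>j. subspace (V j)"
    and output_ip: "\<And>j. semi_inner_product (V j) (ip j)"
    and output_completion: "\<And>j. hilbert_completion (V j) (ip j) (A j) (emb j)"
    and output_score: "\<And>j. linear (score_j j)" "\<And>j. range (score_j j) \<subseteq> V j"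
    and score_out: "\<And>\<phi>. score_out \<phi> = (\<chi> j. score_j j \<phi>)"
    and f_push: "f_push = state_push UNIV ip\<^sub>f emb\<^sub>f score"
    and g_push: "g_push =
      state_push (direct_sum V) (direct_sum_ip ip) (direct_sum_embed emb) score_out"
    and Fj_push_exists: "\<And>j. \<exists>F. is_channel_push f_push (A j)
      (state_push (V j) (ip j) (emb j) (score_j j)) F"
    and Fj_push: "\<And>j. Fj_push j = channel_push f_push (A j)
      (state_push (V j) (ip j) (emb j) (score_j j))"
    and Fj_pull: "\<And>j. Fj_pull j = adjoint_between (tangent_space f_push) (A j) (Fj_push j)"
    and F_push: "F_push = channel_push f_push (direct_sum A) g_push"
    and F_pull: "F_pull = adjoint_between (tangent_space f_push) (direct_sum A) F_push"
    and \<iota>: "\<And>j. \<iota> j = axis j"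
    and \<pi>: "\<And>j. \<pi> j = adjoint_between (A j) (direct_sum A) (\<iota> j)"
    and Imap: "Imap = F_pull \<circ> F_push"
  shows "(\<forall>x\<in>tangent_space f_push. F_push x = (\<Sum>j\<in>UNIV. \<iota> j (Fj_push j x))) \<and>
    (\<forall>y\<in>direct_sum A. F_pull y = (\<Sum>j\<in>UNIV. Fj_pull j (\<pi> j y))) \<and>
    (\<forall>x\<in>tangent_space f_push. Imap x = (\<Sum>j\<in>UNIV. Fj_pull j (Fj_push j x)))"
proof -
  let ?T = "tangent_space f_push"
  have T: "subspace ?T"
    unfolding tangent_space_def f_push
    by (intro subspace_closure subspace_range_state_push[OF input_completion input_score]) simp
  \<comment> \<open>The input completion fills its whole type, so the closed tangent space is
    complete, as the existence of adjoints requires.\<close>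
  have "complete (UNIV :: 'a set)"
    using input_completion by (simp add: hilbert_completion_def)
  then have Tc: "complete ?T"
    using complete_Int_closed[of UNIV ?T] by (simp add: tangent_space_def)
  have A: "subspace (A j)" for j
    using output_completion by (simp add: hilbert_completion_def)
  have Fj: "is_channel_push f_push (A j) (state_push (V j) (ip j) (emb j) (score_j j)) (Fj_push j)" for j
    unfolding Fj_push using Fj_push_exists is_channel_push_channel_push by blast
  \<comment> \<open>Here the identification of the completed direct sum with the direct sum of
    completions enters: each component of an embedded coset is the embedded coset of that
    component.\<close>
  have g: "g_push = (\<lambda>\<phi>. \<chi> j. state_push (V j) (ip j) (emb j) (score_j j) \<phi>)"
    by (simp add: fun_eq_iff vec_eq_iff g_push state_push_def score_out
        direct_sum_embed_coset[of V ip emb, OF output_space output_ip])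
  have cand: "is_channel_push f_push (direct_sum A) g_push (\<lambda>x. \<chi> j. Fj_push j x)"
    unfolding g by (intro is_channel_push_direct_sum Fj)
  then have F: "is_channel_push f_push (direct_sum A) g_push F_push"
    unfolding F_push by (rule is_channel_push_channel_push)
  have F_vec: "F_push x = (\<chi> j. Fj_push j x)" if "x \<in> ?T" for x
    using is_channel_push_unique[OF T F cand that] .
  have F_bl: "bounded_linear_between ?T (direct_sum A) F_push"
    and Fj_bl: "bounded_linear_between ?T (A j) (Fj_push j)" for j
    using F Fj by (auto simp: is_channel_push_def)
  have \<pi>_nth: "\<pi> j y = y $ j" if "y \<in> direct_sum A" for y j
    unfolding \<pi> \<iota> using A that by (rule adjoint_between_axis)
  have push: "F_push x = (\<Sum>j\<in>UNIV. \<iota> j (Fj_push j x))" if "x \<in> ?T" for x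
    by (simp add: F_vec[OF that] \<iota> vec_eq_iff axis_def)
  have pull: "F_pull y = (\<Sum>j\<in>UNIV. Fj_pull j (\<pi> j y))" if y: "y \<in> direct_sum A" for y
    unfolding F_pull
  proof (rule adjoint_between_eqI[OF T Tc F_bl y])
    have yj: "y $ j \<in> A j" for j using y by (simp add: direct_sum_def)
    have "Fj_pull j (y $ j) \<in> ?T" for j
      unfolding Fj_pull using adjoint_between_works(1)[OF T Tc Fj_bl] yj by blast
    then show "(\<Sum>j\<in>UNIV. Fj_pull j (\<pi> j y)) \<in> ?T"
      unfolding \<pi>_nth[OF y] by (intro subspace_sum[OF T])
    fix x assume x: "x \<in> ?T"
    \<comment> \<open>The inner product of the direct sum splits into components, and each term is
      moved across by its own adjoint.\<close>
    have "Fj_push j x \<bullet> y $ j = x \<bullet> Fj_pull j (y $ j)" for j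
      unfolding Fj_pull by (rule adjoint_between_works(2)[OF T Tc Fj_bl x yj])
    then show "F_push x \<bullet> y = x \<bullet> (\<Sum>j\<in>UNIV. Fj_pull j (\<pi> j y))"
      by (simp add: F_vec[OF x] \<pi>_nth[OF y] inner_vec_def inner_sum_right)
  qed
  have "Imap x = (\<Sum>j\<in>UNIV. Fj_pull j (Fj_push j x))" if x: "x \<in> ?T" for x
  proof -
    \<comment> \<open>The formulas for \<open>F_pull\<close> and \<open>\<pi>\<close> are available
      only on the direct sum, so membership comes first; then \<open>\<pi> j\<close> recovers
      \<open>Fj_push j x\<close>.\<close>
    have "F_push x \<in> direct_sum A"
      using F_bl x by (auto simp: bounded_linear_between_def)
    then show ?thesis
      by (simp add: Imap pull \<pi>_nth F_vec[OF x])
  qed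
  with push pull show ?thesis by blast
qed

end
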